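(* Let $(X,V,W,S,\mathcal H_*,h,*,\Theta)$ satisfy the abstract symmetrization framework described in the context. Let $S'$ be a closed subset of $S$ such that $h(S'\times\mathcal H_* )\subseteq S'$ and $*(S')\subseteq S'$. Assume that $f:S'\to\mathbb R\cup\{+\infty\}$ is a proper, lower semi-continuous functional bounded from below such that $f(u^H)\le f(u)$ for all $u\in S'$ and $H\in\mathcal H_*$. Then for all $\rho>0$ and $\sigma>0$ there exists $v\in S'$ such that: (a) $\|v-v^*\|_V<(2K+1)\rho$; (b) $f(w)\ge f(v)-\sigma\|w-v\|$ for all $w\in S'$. In addition, one can assume that $f(v)\le f(u)$ and $\|v-u\|\le\rho+\|\mathbb T_\rho u-u\|$, where $u\in S'$ is some element which satisfies $f(u)\le\inf f+\sigma\rho$.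
   Context: Abstract framework. $X,V,W$ are real Banach spaces with $X\subseteq V\subseteq W$, $X$ continuously embedded in $V$ and $V$ continuously embedded in $W$; $\|\cdot\|$ is the norm of $X$ and $K>0$ is a continuity constant of $X\hookrightarrow V$, i.e. $\|u\|_V\le K\|u\|$ for $u\in X$. $S\subseteq X$ carries the metric induced by $\|\cdot\|$, $\mathcal H_*$ is a path-connected topological space, and there are maps $*:S\to S$, $u\mapsto u^*$ (symmetrization) and $h:S\times\mathcal H_*\to S$, $(u,H)\mapsto u^H$ (polarization) such that: $h$ is continuous; $(u^* )^H=(u^H)^*=u^*$ and $(u^H)^H=u^H$ for all $u\in S$, $H\in\mathcal H_*$; there is a sequence $(H_m)\subset\mathcal H_*$ such that for every $u\in S$ the iterated polarizations $u^{H_1\cdots H_m}$ converge to $u^*$ in $V$ as $m\to\infty$; $\|u^H-v^H\|_V\le\|u-v\|_V$ for all $u,v\in S$, $H\in\mathcal H_*$. Moreover $\Theta:(X,\|\cdot\|_V)\to(S,\|\cdot\|_V)$ is Lipschitz with constant $C_\Theta>0$ and $\Theta|_S=\mathrm{Id}|_S$; for $u\in X$ one sets $u^H:=(\Theta(u))^H$ and $u^*:=(\Theta(u))^*$. For every $\rho>0$, $\mathbb T_\rho:S'\to S'$ denotes a continuous map such that, for every $u\in S'$, $\mathbb T_\rho u$ is obtained from $u$ by finitely many iterated polarizations by elements of $\mathcal H_*$, and $\|\mathbb T_\rho u-u^*\|_V<\rho$ (such maps are known to exist in this framework). Proper means not identically $+\infty$. *)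

theory Defs
  imports "HOL-Analysis.Analysis"
begin

text \<open>The inclusions \<open>X \<subseteq> V \<subseteq> W\<close> of Banach spaces are rendered by injective bounded linear maps
  \<open>\<iota> : X \<rightarrow> V\<close> and \<open>\<kappa> : V \<rightarrow> W\<close>, so the \<open>V\<close>-norm of \<open>u \<in> X\<close> is \<open>norm (\<iota> u)\<close>.
  The space \<open>\<H>\<^sub>*\<close> of polarizers is an abstract topology \<open>HH\<close>; \<open>star u\<close> is \<open>u\<^sup>*\<close> and \<open>pol u H\<close> is
  \<open>u\<^sup>H\<close>. Both are only constrained on \<open>S\<close> (and \<open>topspace HH\<close>). The iterated polarization
  \<open>u\<^sup>H\<^sup>1\<^sup>\<dots>\<^sup>H\<^sup>m = (\<dots>(u\<^sup>H\<^sup>1)\<dots>)\<^sup>H\<^sup>m\<close> is \<open>foldl pol u [H1, \<dots>, Hm]\<close>. The extensions to \<open>u \<in> X\<close>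
  are \<open>pol (\<Theta> u) H\<close> and \<open>star (\<Theta> u)\<close>; they agree with \<open>pol u H\<close> and \<open>star u\<close> for \<open>u \<in> S\<close>
  by \<open>Theta_id\<close>.\<close>

locale symmetrization_framework =
  fixes \<iota> :: "'x::banach \<Rightarrow> 'v::banach"
    and \<kappa> :: "'v \<Rightarrow> 'w::banach"
    and K :: real
    and S :: "'x set"
    and HH :: "'h topology"
    and star :: "'x \<Rightarrow> 'x"
    and pol :: "'x \<Rightarrow> 'h \<Rightarrow> 'x"
    and \<Theta> :: "'x \<Rightarrow> 'x"
    and C\<Theta> :: real
  assumes emb_XV: "bounded_linear \<iota>" "inj \<iota>"
    and emb_VW: "bounded_linear \<kappa>" "inj \<kappa>"
    and K_pos: "K > 0"
    and K_bound: "norm (\<iota> u) \<le> K * norm u"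
    and path_connected_HH: "path_connected_space HH"
    and star_in: "u \<in> S \<Longrightarrow> star u \<in> S"
    and pol_in: "u \<in> S \<Longrightarrow> H \<in> topspace HH \<Longrightarrow> pol u H \<in> S"
    and pol_continuous:
      "continuous_map (prod_topology (top_of_set S) HH) (top_of_set S) (\<lambda>(u, H). pol u H)"
    and pol_star: "u \<in> S \<Longrightarrow> H \<in> topspace HH \<Longrightarrow> pol (star u) H = star u"
    and star_pol: "u \<in> S \<Longrightarrow> H \<in> topspace HH \<Longrightarrow> star (pol u H) = star u"
    and pol_idem: "u \<in> S \<Longrightarrow> H \<in> topspace HH \<Longrightarrow> pol (pol u H) H = pol u H"
    and approximation:
      "\<exists>Hs :: nat \<Rightarrow> 'h. range Hs \<subseteq> topspace HH \<and>
        (\<forall>u\<in>S. (\<lambda>m. \<iota> (foldl pol u (map Hs [0..<m]))) \<longlonglongrightarrow> \<iota> (star u))"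
    and pol_contraction:
      "u \<in> S \<Longrightarrow> v \<in> S \<Longrightarrow> H \<in> topspace HH \<Longrightarrow>
        norm (\<iota> (pol u H) - \<iota> (pol v H)) \<le> norm (\<iota> u - \<iota> v)"
    and Theta_in: "\<Theta> u \<in> S"
    and CTheta_pos: "C\<Theta> > 0"
    and Theta_lipschitz: "norm (\<iota> (\<Theta> u) - \<iota> (\<Theta> v)) \<le> C\<Theta> * norm (\<iota> u - \<iota> v)"
    and Theta_id: "u \<in> S \<Longrightarrow> \<Theta> u = u"

definition lsc_on :: "'a::topological_space set \<Rightarrow> ('a \<Rightarrow> ereal) \<Rightarrow> bool" where
  "lsc_on A f \<longleftrightarrow> (\<forall>x\<in>A. f x \<le> Liminf (at x within A) f)"

text \<open>\<open>is_polarization_map \<iota> HH star pol S' \<rho> T\<close>: the map \<open>T\<close> is a possible choice of \<open>\<T>\<^sub>\<rho>\<close> on \<open>S'\<close>.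
  The polarizers used for \<open>T u\<close> may depend on \<open>u\<close>.\<close>

definition is_polarization_map ::
  "('x::banach \<Rightarrow> 'v::banach) \<Rightarrow> 'h topology \<Rightarrow> ('x \<Rightarrow> 'x) \<Rightarrow> ('x \<Rightarrow> 'h \<Rightarrow> 'x) \<Rightarrow>
    'x set \<Rightarrow> real \<Rightarrow> ('x \<Rightarrow> 'x) \<Rightarrow> bool" where
  "is_polarization_map \<iota> HH star pol S' \<rho> T \<longleftrightarrow>
    T ` S' \<subseteq> S' \<and> continuous_on S' T \<and>
    (\<forall>u\<in>S'. (\<exists>Hs. set Hs \<subseteq> topspace HH \<and> T u = foldl pol u Hs) \<and>
            norm (\<iota> (T u) - \<iota> (star u)) < \<rho>)"

end

theory Submission
  imports Defs
begin

text \<open>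
  Starting from an almost minimizer \<open>u\<close>, polarize finitely often to reach \<open>x\<close> with \<open>\<parallel>x - u\<^sup>*\<parallel>\<^sub>V < \<rho>\<close>;
  this does not increase \<open>f\<close>, so Ekeland's principle started at \<open>x\<close> yields \<open>v\<close> with
  \<open>\<parallel>v - x\<parallel> \<le> \<rho>\<close>. Symmetrization is a contraction in \<open>V\<close> (as a limit of polarizations) and
  \<open>x\<^sup>* = u\<^sup>*\<close>, whence \<open>\<parallel>v - v\<^sup>*\<parallel>\<^sub>V \<le> \<parallel>v - x\<parallel>\<^sub>V + \<parallel>x - u\<^sup>*\<parallel>\<^sub>V + \<parallel>x\<^sup>* - v\<^sup>*\<parallel>\<^sub>V < K\<rho> + \<rho> + K\<rho>\<close>.
  The completeness of \<open>S'\<close> required by Ekeland's principle comes from the retraction \<open>\<Theta>\<close>: its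
  set of fixed points \<open>S\<close> is closed in \<open>X\<close>.
\<close>

section \<open>Lower semicontinuity and Ekeland's variational principle\<close>

lemma lsc_on_le_limit:
  fixes f :: "'a::metric_space \<Rightarrow> ereal"
  assumes lsc: "lsc_on A f" and v: "v \<in> A"
    and y: "y \<longlonglongrightarrow> v" "\<forall>\<^sub>F k in sequentially. y k \<in> A"
    and r: "r \<longlonglongrightarrow> L" "\<forall>\<^sub>F k in sequentially. f (y k) \<le> r k"
  shows "f v \<le> L"
proof (rule ccontr)
  assume "\<not> f v \<le> L"
  then obtain C where C: "L < C" "C < f v"
    using dense by (metis not_le)
  have "C < Liminf (at v within A) f"
    using lsc v C(2) unfolding lsc_on_def by (meson less_le_trans)
  then have "\<forall>\<^sub>F x in at v within A. C < f x"
    by (rule less_LiminfD)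
  \<comment> \<open>The filter \<open>at v within A\<close> leaves out \<open>v\<close>, which the
    sequence may hit; there \<open>C < f v\<close> takes over.\<close>
  then have "\<forall>\<^sub>F x in nhds v. x \<in> A \<longrightarrow> C < f x"
    unfolding eventually_at_filter by eventually_elim (use C(2) in auto)
  then have "\<forall>\<^sub>F k in sequentially. y k \<in> A \<longrightarrow> C < f (y k)"
    using y(1) by (auto simp: filterlim_iff)
  moreover have "\<forall>\<^sub>F k in sequentially. r k < C"
    using order_tendstoD(2)[OF r(1) C(1)] .
  ultimately have "\<forall>\<^sub>F k in sequentially. False"
    using y(2) r(2) by eventually_elim auto
  then show False
    by simp
qed

text \<open>Let y lie below x when \<open>f\<close> drops from x to y by at least \<sigma> times
  their distance; \<open>F x\<close> collects these points. A sequence descending from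
  \<open>x0\<close> by nearly minimal choices converges, and nothing but its limit lies below the
  limit.\<close>

lemma ekeland_variational_principle:
  fixes f :: "'a::metric_space \<Rightarrow> ereal"
  assumes A: "complete A" and lsc: "lsc_on A f"
    and bdd: "\<And>x. x \<in> A \<Longrightarrow> ereal c \<le> f x"
    and x0: "x0 \<in> A" "f x0 \<noteq> \<infinity>" and \<sigma>: "\<sigma> > 0"
  obtains v where "v \<in> A" "f v + ereal (\<sigma> * dist x0 v) \<le> f x0"
    "\<And>w. w \<in> A \<Longrightarrow> w \<noteq> v \<Longrightarrow> f v < f w + ereal (\<sigma> * dist v w)"
proof -
  define F where "F x = {y \<in> A. f y + ereal (\<sigma> * dist x y) \<le> f x}" for x
  have F_trans: "z \<in> F x" if "y \<in> F x" "z \<in> F y" for x y z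
  proof -
    have "f z + ereal (\<sigma> * dist x z) \<le> f z + ereal (\<sigma> * dist y z + \<sigma> * dist x y)"
      using \<sigma> dist_triangle[of x z y]
      by (intro add_left_mono) (simp flip: distrib_left add: add.commute)
    also have "\<dots> = (f z + ereal (\<sigma> * dist y z)) + ereal (\<sigma> * dist x y)"
      by (simp add: add.assoc)
    also have "\<dots> \<le> f y + ereal (\<sigma> * dist x y)"
      using that by (intro add_right_mono) (simp add: F_def)
    also have "\<dots> \<le> f x"
      using that by (simp add: F_def)
    finally show ?thesis
      using that by (simp add: F_def)
  qed
  have F_fin: "f y \<noteq> \<infinity>" if "y \<in> F x" "f x \<noteq> \<infinity>" for x y
    using that by (auto simp: F_def)
  have F_refl: "x \<in> F x" if "x \<in> A" for x
    using that by (simp add: F_def)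
  \<comment> \<open>The infimum over \<open>F x\<close> lies between \<open>c\<close> and
    \<open>f x\<close>, so it is finite and adding \<open>e\<close> strictly enlarges it.\<close>
  have step: "\<exists>y\<in>F x. \<forall>z\<in>F x. f y \<le> f z + ereal e" if "x \<in> A" "f x \<noteq> \<infinity>" "e > 0" for x e
  proof -
    let ?I = "INF z\<in>F x. f z"
    have "ereal c \<le> ?I"
      using bdd by (intro INF_greatest) (auto simp: F_def)
    moreover have "?I \<le> f x"
      using F_refl[OF that(1)] by (rule INF_lower)
    ultimately have "\<bar>?I\<bar> \<noteq> \<infinity>"
      using that(2) by auto
    then have "?I < ?I + ereal e"
      using that(3) by (cases ?I) auto
    then obtain y where "y \<in> F x" "f y < ?I + ereal e"
      unfolding INF_less_iff by auto
    then show ?thesis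
      by (meson INF_lower add_right_mono le_less_trans less_imp_le order.trans)
  qed
  \<comment> \<open>The clause for \<open>n = 0\<close> pins the start of the chosen sequence to
    \<open>x0\<close>; finiteness is carried along because \<open>step\<close> requires it.\<close>
  have "\<exists>x. \<forall>n. (x n \<in> A \<and> f (x n) \<noteq> \<infinity> \<and> (n = 0 \<longrightarrow> x n = x0)) \<and>
      (x (Suc n) \<in> F (x n) \<and> (\<forall>z\<in>F (x n). f (x (Suc n)) \<le> f z + ereal ((1/2)^n)))"
  proof (rule dependent_nat_choice)
    show "\<exists>x. x \<in> A \<and> f x \<noteq> \<infinity> \<and> ((0::nat) = 0 \<longrightarrow> x = x0)"
      using x0 by auto
  next
    fix x and n :: nat assume x: "x \<in> A \<and> f x \<noteq> \<infinity> \<and> (n = 0 \<longrightarrow> x = x0)"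
    then obtain y where "y \<in> F x" "\<forall>z\<in>F x. f y \<le> f z + ereal ((1/2)^n)"
      using step[of x "(1/2)^n"] by auto
    then show "\<exists>y. (y \<in> A \<and> f y \<noteq> \<infinity> \<and> (Suc n = 0 \<longrightarrow> y = x0)) \<and>
        y \<in> F x \<and> (\<forall>z\<in>F x. f y \<le> f z + ereal ((1/2)^n))"
      using F_fin[of y x] x by (auto simp: F_def)
  qed
  then obtain x :: "nat \<Rightarrow> 'a" where xA: "\<And>n. x n \<in> A" and xfin: "\<And>n. f (x n) \<noteq> \<infinity>" and x_0: "x 0 = x0"
    and xF: "\<And>n. x (Suc n) \<in> F (x n)"
    and xmin: "\<And>n z. z \<in> F (x n) \<Longrightarrow> f (x (Suc n)) \<le> f z + ereal ((1/2)^n)"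
    by metis
  have xF': "x m \<in> F (x n)" if "n \<le> m" for n m
    using that by (induction m rule: dec_induct) (auto intro: F_refl xA F_trans xF)
  \<comment> \<open>Any \<open>z\<close> below \<open>x (Suc n)\<close> is also below
    \<open>x n\<close>, so near-minimality caps the drop of \<open>f\<close> by
    \<open>(1/2)^n\<close>, and the drop controls the distance.\<close>
  have small: "dist (x (Suc n)) z \<le> (1/2)^n / \<sigma>" if z: "z \<in> F (x (Suc n))" for n z
  proof -
    have "f z + ereal (\<sigma> * dist (x (Suc n)) z) \<le> f z + ereal ((1/2)^n)"
      using z xmin[OF F_trans[OF xF z]] unfolding F_def by (auto intro: order.trans)
    moreover have "f z \<noteq> \<infinity>" "f z \<noteq> -\<infinity>"
      using F_fin[OF z xfin] bdd[of z] z by (auto simp: F_def)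
    ultimately have "\<sigma> * dist (x (Suc n)) z \<le> (1/2)^n"
      by (cases "f z") auto
    then show ?thesis
      using \<sigma> by (simp add: field_simps)
  qed
  have lim0: "(\<lambda>n. (1/2)^n / \<sigma>) \<longlonglongrightarrow> 0"
    using tendsto_divide[OF LIMSEQ_power_zero[of "1/2::real"] tendsto_const[of \<sigma>]] \<sigma> by simp
  have "Cauchy x"
  proof (rule metric_CauchyI)
    fix e :: real assume "e > 0"
    then have "\<forall>\<^sub>F n in sequentially. (1/2)^n / \<sigma> < e/2"
      using order_tendstoD(2)[OF lim0, of "e/2"] by simp
    then obtain n where n: "(1/2)^n / \<sigma> < e/2"
      by (auto simp: eventually_sequentially)
    have "dist (x k) (x l) < e" if "Suc n \<le> k" "Suc n \<le> l" for k l
      using small[OF xF'[OF that(1)]] small[OF xF'[OF that(2)]] n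
        dist_triangle3[of "x k" "x l" "x (Suc n)"] by linarith
    then show "\<exists>M. \<forall>m\<ge>M. \<forall>n\<ge>M. dist (x m) (x n) < e"
      by blast
  qed
  then obtain v where v: "v \<in> A" "x \<longlonglongrightarrow> v"
    using A xA by (meson completeE)
  \<comment> \<open>The tail of the sequence lies in \<open>F (x n)\<close>. As
    \<open>f (x n)\<close> is finite, membership is a real upper bound on \<open>f\<close> depending
    continuously on the point, and lower semicontinuity carries it to \<open>v\<close>.\<close>
  have vF: "v \<in> F (x n)" for n
  proof -
    obtain a where a: "f (x n) = ereal a"
      using xfin[of n] bdd[OF xA[of n]] by (cases "f (x n)") auto
    have "f v \<le> ereal (a - \<sigma> * dist (x n) v)"
    proof (rule lsc_on_le_limit[OF lsc v(1,2)])
      show "(\<lambda>k. ereal (a - \<sigma> * dist (x n) (x k))) \<longlonglongrightarrow> ereal (a - \<sigma> * dist (x n) v)"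
        by (intro tendsto_intros v)
      have "f (x k) \<le> ereal (a - \<sigma> * dist (x n) (x k))" if "k \<ge> n" for k
        using xF'[OF that] a unfolding F_def by (cases "f (x k)") auto
      then show "\<forall>\<^sub>F k in sequentially. f (x k) \<le> ereal (a - \<sigma> * dist (x n) (x k))"
        by (auto simp: eventually_sequentially)
    qed (use xA in auto)
    then show ?thesis
      using a v(1) unfolding F_def by (cases "f v") auto
  qed
  show ?thesis
  proof
    show "v \<in> A" by fact
    show "f v + ereal (\<sigma> * dist x0 v) \<le> f x0"
      using vF[of 0] by (simp add: F_def x_0)
    fix w assume w: "w \<in> A" "w \<noteq> v"
    \<comment> \<open>A violating \<open>w\<close> would lie below \<open>v\<close>, hence below
      every \<open>x n\<close>; the shrinking bounds make it a second limit of the sequence.\<close>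
    show "f v < f w + ereal (\<sigma> * dist v w)"
    proof (rule ccontr)
      assume "\<not> f v < f w + ereal (\<sigma> * dist v w)"
      then have "w \<in> F v"
        using w by (simp add: F_def)
      then have "dist (x (Suc n)) w \<le> (1/2)^n / \<sigma>" for n
        using small F_trans[OF vF] by blast
      then have "(\<lambda>n. dist (x (Suc n)) w) \<longlonglongrightarrow> 0"
        by (intro tendsto_sandwich[OF _ _ tendsto_const lim0]) auto
      then have "(\<lambda>n. x (Suc n)) \<longlonglongrightarrow> w"
        by (rule tendsto_dist_iff[THEN iffD2])
      moreover have "(\<lambda>n. x (Suc n)) \<longlonglongrightarrow> v"
        using v(2) by (rule LIMSEQ_Suc)
      ultimately show False
        using w(2) LIMSEQ_unique by blast
    qed
  qed
qed

section \<open>Symmetrization as a limit of polarizations; closedness of \<open>S\<close>\<close>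

context symmetrization_framework
begin

lemma iterated_pol_in: "u \<in> S \<Longrightarrow> set Hs \<subseteq> topspace HH \<Longrightarrow> foldl pol u Hs \<in> S"
  by (induction Hs arbitrary: u) (auto simp: pol_in)

lemma star_iterated_pol: "u \<in> S \<Longrightarrow> set Hs \<subseteq> topspace HH \<Longrightarrow> star (foldl pol u Hs) = star u"
  by (induction Hs arbitrary: u) (auto simp: pol_in star_pol)

lemma iterated_pol_contraction:
  "u \<in> S \<Longrightarrow> v \<in> S \<Longrightarrow> set Hs \<subseteq> topspace HH \<Longrightarrow>
    norm (\<iota> (foldl pol u Hs) - \<iota> (foldl pol v Hs)) \<le> norm (\<iota> u - \<iota> v)"
proof (induction Hs arbitrary: u v)
  case (Cons H Hs)
  then show ?case
    using order.trans[OF Cons.IH[of "pol u H" "pol v H"] pol_contraction[of u v H]]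
    by (simp add: pol_in)
qed auto

text \<open>One sequence of polarizers serves all points of \<open>S\<close>, so both iterates can
  be compared at each stage and the bound survives the limit in V.\<close>

lemma star_contraction:
  assumes "u \<in> S" "v \<in> S"
  shows "norm (\<iota> (star u) - \<iota> (star v)) \<le> norm (\<iota> u - \<iota> v)"
proof -
  obtain Hs :: "nat \<Rightarrow> 'h" where Hs: "range Hs \<subseteq> topspace HH"
    and lim: "\<And>u. u \<in> S \<Longrightarrow> (\<lambda>m. \<iota> (foldl pol u (map Hs [0..<m]))) \<longlonglongrightarrow> \<iota> (star u)"
    using approximation by blast
  have "set (map Hs [0..<m]) \<subseteq> topspace HH" for m
    using Hs by auto
  then show ?thesis
    using assms by (intro tendsto_le[OF _ tendsto_const tendsto_norm[OF tendsto_diff[OF lim lim]]])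
      (auto intro!: always_eventually iterated_pol_contraction simp del: set_map)
qed

text \<open>Truncating the universal sequence yields the finite list of polarizers for the existence
  claim that refers to no given map \<open>T\<close>.\<close>

lemma iterated_pol_approximates_star:
  assumes "u \<in> S" "e > 0"
  obtains Hs where "set Hs \<subseteq> topspace HH" "norm (\<iota> (foldl pol u Hs) - \<iota> (star u)) < e"
proof -
  obtain Hs :: "nat \<Rightarrow> 'h" where Hs: "range Hs \<subseteq> topspace HH"
    and lim: "(\<lambda>m. \<iota> (foldl pol u (map Hs [0..<m]))) \<longlonglongrightarrow> \<iota> (star u)"
    using approximation assms(1) by blast
  obtain m where "norm (\<iota> (foldl pol u (map Hs [0..<m])) - \<iota> (star u)) < e"
    using LIMSEQ_D[OF lim assms(2)] by blast
  then show ?thesis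
    using Hs that[of "map Hs [0..<m]"] by auto
qed

text \<open>The Lipschitz bound on \<open>\<Theta>\<close> is in the V-norm, so limits are compared
  in V: if points \<open>y n = \<Theta> (y n)\<close> tend to \<open>l\<close>, their images under
  \<open>\<iota>\<close> tend to both \<open>\<iota> l\<close> and
  \<open>\<iota> (\<Theta> l)\<close>, and injectivity of \<open>\<iota>\<close> gives
  \<open>\<Theta> l = l\<close>.\<close>

lemma closed_S: "closed S"
  unfolding closed_sequential_limits
proof (intro allI impI, elim conjE)
  fix y l assume y: "\<forall>n. y n \<in> S" "y \<longlonglongrightarrow> l"
  have lim: "(\<lambda>n. \<iota> (y n)) \<longlonglongrightarrow> \<iota> l"
    using emb_XV(1) y(2) by (rule bounded_linear.tendsto)
  then have "(\<lambda>n. C\<Theta> * norm (\<iota> (y n) - \<iota> l)) \<longlonglongrightarrow> 0"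
    by (intro tendsto_mult_right_zero tendsto_norm_zero LIM_zero)
  then have "(\<lambda>n. \<iota> (y n) - \<iota> (\<Theta> l)) \<longlonglongrightarrow> 0"
    by (rule Lim_null_comparison[rotated])
      (use y(1) Theta_lipschitz[of "y _" l] in \<open>simp add: Theta_id\<close>)
  then have "(\<lambda>n. \<iota> (y n)) \<longlonglongrightarrow> \<iota> (\<Theta> l)"
    by (rule LIM_zero_cancel)
  then have "\<iota> (\<Theta> l) = \<iota> l"
    using lim LIMSEQ_unique by blast
  then show "l \<in> S"
    using emb_XV(2) Theta_in[of l] by (simp add: inj_eq)
qed

text \<open>Working with one list \<open>Hs\<close> at one point \<open>u\<close>, rather than with
  a map, lets the truncated sequence and any admissible \<open>T\<close> be treated alike.\<close>

lemma ekeland_near_iterated_polarization: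
  fixes f :: "'x \<Rightarrow> ereal"
  assumes S': "closedin (top_of_set S) S'"
    and pol_S': "\<And>u H. u \<in> S' \<Longrightarrow> H \<in> topspace HH \<Longrightarrow> pol u H \<in> S'"
    and lsc: "lsc_on S' f" and bdd: "\<And>x. x \<in> S' \<Longrightarrow> ereal c \<le> f x"
    and proper: "\<exists>x\<in>S'. f x \<noteq> \<infinity>"
    and f_pol: "\<And>u H. u \<in> S' \<Longrightarrow> H \<in> topspace HH \<Longrightarrow> f (pol u H) \<le> f u"
    and \<sigma>: "\<sigma> > 0"
    and u: "u \<in> S'" "f u \<le> (INF x\<in>S'. f x) + ereal (\<sigma> * \<rho>)"
    and Hs: "set Hs \<subseteq> topspace HH"
    and close: "norm (\<iota> (foldl pol u Hs) - \<iota> (star u)) < \<rho>"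
  obtains v where "v \<in> S'" "norm (\<iota> v - \<iota> (star v)) < (2 * K + 1) * \<rho>"
    "\<forall>w\<in>S'. f w \<ge> f v - ereal (\<sigma> * norm (w - v))"
    "f v \<le> f u" "norm (v - u) \<le> \<rho> + norm (foldl pol u Hs - u)"
proof -
  define x where "x = foldl pol u Hs"
  have S'S: "S' \<subseteq> S"
    using S' by (rule closedin_imp_subset)
  have "closed S'"
    using S' closed_S by (rule closedin_closed_trans)
  then have complete: "complete S'"
    by (simp add: complete_eq_closed)
  have "foldl pol w Hs \<in> S' \<and> f (foldl pol w Hs) \<le> f w" if "w \<in> S'" for w
    using that Hs
  proof (induction Hs arbitrary: w)
    case (Cons H Hs)
    then show ?case
      using Cons.IH[of "pol w H"] pol_S'[of w H] order.trans[OF _ f_pol[of w H]] by auto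
  qed auto
  then have x: "x \<in> S'" "f x \<le> f u"
    using u(1) by (auto simp: x_def)
  \<comment> \<open>Polarizing does not raise \<open>f\<close>, so \<open>x\<close> inherits the
    near-minimality of \<open>u\<close>; comparison with a point of finite value then makes
    \<open>f x\<close> finite.\<close>
  have x_le: "f x \<le> f v + ereal (\<sigma> * \<rho>)" if "v \<in> S'" for v
    using x(2) u(2) INF_lower[of v S' f] that by (meson add_right_mono order.trans)
  have x_fin: "f x \<noteq> \<infinity>"
    using proper x_le by fastforce
  obtain v where v: "v \<in> S'" "f v + ereal (\<sigma> * dist x v) \<le> f x"
    and min: "\<And>w. w \<in> S' \<Longrightarrow> w \<noteq> v \<Longrightarrow> f v < f w + ereal (\<sigma> * dist v w)"
    using ekeland_variational_principle[OF complete lsc bdd x(1) x_fin \<sigma>] by blast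
  obtain a where a: "f v = ereal a"
    using v(2) x_fin bdd[OF v(1)] by (cases "f v") auto
  obtain b where b: "f x = ereal b"
    using x_fin bdd[OF x(1)] by (cases "f x") auto
  \<comment> \<open>From \<open>x\<close> to \<open>v\<close> the functional drops by at least
    \<sigma> times the distance, but by at most \<sigma>\<rho> by near-minimality; this is where the
    radius \<rho> comes from.\<close>
  have ab: "a + \<sigma> * dist x v \<le> b" "b \<le> a + \<sigma> * \<rho>"
    using v(2) x_le[OF v(1)] a b by simp_all
  then have "\<sigma> * dist x v \<le> \<sigma> * \<rho>"
    by linarith
  then have xv: "norm (v - x) \<le> \<rho>"
    using \<sigma> by (simp add: dist_norm norm_minus_commute)
  have \<iota>_vx: "norm (\<iota> v - \<iota> x) \<le> K * \<rho>"
  proof -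
    have "norm (\<iota> v - \<iota> x) = norm (\<iota> (v - x))"
      using emb_XV(1) by (simp add: bounded_linear.linear linear_diff)
    also have "\<dots> \<le> K * norm (v - x)"
      by (rule K_bound)
    also have "\<dots> \<le> K * \<rho>"
      using xv K_pos by simp
    finally show ?thesis .
  qed
  have "star x = star u"
    using star_iterated_pol Hs u(1) S'S by (auto simp: x_def)
  then have "norm (\<iota> (star u) - \<iota> (star v)) \<le> norm (\<iota> x - \<iota> v)"
    using star_contraction[of x v] x(1) v(1) S'S by auto
  moreover have "norm (\<iota> v - \<iota> (star v)) \<le>
      norm (\<iota> v - \<iota> x) + norm (\<iota> x - \<iota> (star u)) + norm (\<iota> (star u) - \<iota> (star v))"
    by norm
  moreover have "norm (\<iota> x - \<iota> v) = norm (\<iota> v - \<iota> x)"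
    by (rule norm_minus_commute)
  \<comment> \<open>Strictness comes from \<open>close\<close>; the displacement from
    \<open>x\<close> to \<open>v\<close> and that of their symmetrizations cost
    \<open>K * \<rho>\<close> each.\<close>
  ultimately have "norm (\<iota> v - \<iota> (star v)) < K * \<rho> + \<rho> + K * \<rho>"
    using close \<iota>_vx unfolding x_def[symmetric] by linarith
  then have "norm (\<iota> v - \<iota> (star v)) < (2 * K + 1) * \<rho>"
    by (simp add: algebra_simps)
  \<comment> \<open>Ekeland's inequality covers only \<open>w \<noteq> v\<close>; since
    \<open>f v = ereal a\<close> is finite, the penalty can be moved to the other side.\<close>
  moreover have "f w \<ge> f v - ereal (\<sigma> * norm (w - v))" if "w \<in> S'" for w
  proof (cases "w = v")
    case False
    then show ?thesis
      using min[OF that] a by (cases "f w") (auto simp: dist_norm norm_minus_commute)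
  qed (simp add: a)
  moreover have "f v \<le> f u"
  proof -
    have "a \<le> b"
      using ab(1) \<sigma> zero_le_dist[of x v] by (smt (verit) mult_nonneg_nonneg)
    then show ?thesis
      using x(2) a b by (metis ereal_less_eq(3) order.trans)
  qed
  moreover have "norm (v - u) \<le> \<rho> + norm (x - u)"
    using xv norm_triangle_ineq[of "v - x" "x - u"] by simp
  ultimately show ?thesis
    using that[OF v(1)] by (auto simp: x_def)
qed

end

section \<open>Almost symmetric points of Ekeland type\<close>

theorem theorem2p7:
  fixes \<iota> :: "'x::banach \<Rightarrow> 'v::banach"
    and \<kappa> :: "'v \<Rightarrow> 'w::banach"
    and K C\<Theta> :: real
    and S S' :: "'x set"
    and HH :: "'h topology"
    and star :: "'x \<Rightarrow> 'x"
    and pol :: "'x \<Rightarrow> 'h \<Rightarrow> 'x"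
    and \<Theta> :: "'x \<Rightarrow> 'x"
    and f :: "'x \<Rightarrow> ereal"
  assumes framework: "symmetrization_framework \<iota> \<kappa> K S HH star pol \<Theta> C\<Theta>"
    and closed: "closedin (top_of_set S) S'"
    and pol_S': "\<forall>u\<in>S'. \<forall>H\<in>topspace HH. pol u H \<in> S'"
    and star_S': "star ` S' \<subseteq> S'"
    and f_range: "\<forall>u\<in>S'. f u \<noteq> - \<infinity>"
    and f_proper: "\<exists>u\<in>S'. f u \<noteq> \<infinity>"
    and f_lsc: "lsc_on S' f"
    and f_bdd_below: "\<exists>c::real. \<forall>u\<in>S'. ereal c \<le> f u"
    and f_pol: "\<forall>u\<in>S'. \<forall>H\<in>topspace HH. f (pol u H) \<le> f u"
  shows "\<forall>\<rho>>0. \<forall>\<sigma>>0.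
    (\<exists>v\<in>S'.
        norm (\<iota> v - \<iota> (star v)) < (2 * K + 1) * \<rho> \<and>
        (\<forall>w\<in>S'. f w \<ge> f v - ereal (\<sigma> * norm (w - v)))) \<and>
    (\<exists>u\<in>S'. f u \<le> (INF x\<in>S'. f x) + ereal (\<sigma> * \<rho>)) \<and>
    (\<forall>T. is_polarization_map \<iota> HH star pol S' \<rho> T \<longrightarrow>
      (\<forall>u\<in>S'. f u \<le> (INF x\<in>S'. f x) + ereal (\<sigma> * \<rho>) \<longrightarrow>
        (\<exists>v\<in>S'.
            norm (\<iota> v - \<iota> (star v)) < (2 * K + 1) * \<rho> \<and>
            (\<forall>w\<in>S'. f w \<ge> f v - ereal (\<sigma> * norm (w - v))) \<and>
            f v \<le> f u \<and>
            norm (v - u) \<le> \<rho> + norm (T u - u))))"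
proof (intro allI impI)
  fix \<rho> \<sigma> :: real assume \<rho>: "\<rho> > 0" and \<sigma>: "\<sigma> > 0"
  interpret symmetrization_framework \<iota> \<kappa> K S HH star pol \<Theta> C\<Theta>
    by (rule framework)
  obtain c where c: "\<And>x. x \<in> S' \<Longrightarrow> ereal c \<le> f x"
    using f_bdd_below by blast
  let ?I = "INF x\<in>S'. f x"
  let ?min = "\<lambda>u. f u \<le> ?I + ereal (\<sigma> * \<rho>)"
  let ?ab = "\<lambda>v. norm (\<iota> v - \<iota> (star v)) < (2 * K + 1) * \<rho> \<and>
    (\<forall>w\<in>S'. f w \<ge> f v - ereal (\<sigma> * norm (w - v)))"
  have key: "\<exists>v\<in>S'. ?ab v \<and> f v \<le> f u \<and> norm (v - u) \<le> \<rho> + norm (foldl pol u Hs - u)"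
    if "u \<in> S'" "?min u" "set Hs \<subseteq> topspace HH"
      "norm (\<iota> (foldl pol u Hs) - \<iota> (star u)) < \<rho>" for u Hs
    using ekeland_near_iterated_polarization
        [OF closed _ f_lsc c f_proper _ \<sigma> that] pol_S' f_pol by (metis (no_types, lifting))
  \<comment> \<open>The infimum is at least \<open>c\<close>, and properness keeps it below
    \<infinity>; being finite, it is strictly less than itself plus \<sigma>\<rho>.\<close>
  have ex_min: "\<exists>u\<in>S'. ?min u"
  proof -
    have "ereal c \<le> ?I"
      using c by (rule INF_greatest)
    moreover obtain y where "y \<in> S'" "f y \<noteq> \<infinity>"
      using f_proper by blast
    then have "?I \<noteq> \<infinity>"
      by (metis INF_lower ereal_infty_less_eq(1))
    ultimately have "?I < ?I + ereal (\<sigma> * \<rho>)"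
      using \<rho> \<sigma> by (cases ?I) auto
    then obtain u where "u \<in> S'" "f u < ?I + ereal (\<sigma> * \<rho>)"
      unfolding INF_less_iff by blast
    then show ?thesis
      by (auto intro: less_imp_le)
  qed
  have "\<exists>v\<in>S'. ?ab v"
  proof -
    obtain u where u: "u \<in> S'" "?min u"
      using ex_min by blast
    have "u \<in> S"
      using u(1) closedin_imp_subset[OF closed] by blast
    then obtain Hs where "set Hs \<subseteq> topspace HH" "norm (\<iota> (foldl pol u Hs) - \<iota> (star u)) < \<rho>"
      using iterated_pol_approximates_star \<rho> by blast
    then show ?thesis
      using key[OF u] by blast
  qed
  moreover have "\<exists>v\<in>S'. norm (\<iota> v - \<iota> (star v)) < (2 * K + 1) * \<rho> \<and>
      (\<forall>w\<in>S'. f w \<ge> f v - ereal (\<sigma> * norm (w - v))) \<and>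
      f v \<le> f u \<and> norm (v - u) \<le> \<rho> + norm (T u - u)"
    if T: "is_polarization_map \<iota> HH star pol S' \<rho> T" and u: "u \<in> S'" "?min u" for T u
  proof -
    \<comment> \<open>The list is read off from the value of \<open>T\<close> at this particular
      \<open>u\<close>, so it may vary with \<open>u\<close>.\<close>
    obtain Hs where "set Hs \<subseteq> topspace HH" "T u = foldl pol u Hs"
      "norm (\<iota> (T u) - \<iota> (star u)) < \<rho>"
      using T u(1) unfolding is_polarization_map_def by blast
    then show ?thesis
      using key[OF u, of Hs] by auto
  qed
  ultimately show "(\<exists>v\<in>S'. ?ab v) \<and> (\<exists>u\<in>S'. ?min u) \<and>
    (\<forall>T. is_polarization_map \<iota> HH star pol S' \<rho> T \<longrightarrow>
      (\<forall>u\<in>S'. ?min u \<longrightarrow>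
        (\<exists>v\<in>S'.
            norm (\<iota> v - \<iota> (star v)) < (2 * K + 1) * \<rho> \<and>
            (\<forall>w\<in>S'. f w \<ge> f v - ereal (\<sigma> * norm (w - v))) \<and>
            f v \<le> f u \<and>
            norm (v - u) \<le> \<rho> + norm (T u - u))))"
    using ex_min by blast
qed

end
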